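(* Let $\Bbbk$ be a field. For all integers $n\ge3$ and $1\le q\le\lfloor n/2\rfloor$, let $\mathcal W_n$ be the wheel graph on $\{x_1,\ldots,x_n,v\}$ and $R=\Bbbk[x_1,\ldots,x_n,v]$. Then the Krull dimension of $R/I(\mathcal W_n)^{[q]}$ and the height of $I(\mathcal W_n)^{[q]}$ are \[ \dim\big(R/I(\mathcal W_n)^{[q]}\big)=\Big\lfloor\frac n2\Big\rfloor+q-1,\qquad \operatorname{ht}\big(I(\mathcal W_n)^{[q]}\big)=(n+1)-\Big\lfloor\frac n2\Big\rfloor-q+1 . \]
   Context: For $n\ge3$, the wheel graph $\mathcal W_n$ has vertex set $\{x_1,\ldots,x_n,v\}$; the vertices $x_1,\ldots,x_n$ form a cycle $\mathcal C_n$ of length $n$, and $v$ is adjacent to all of $x_1,\ldots,x_n$. A $q$-matching of a graph is a set $M$ of $q$ pairwise vertex-disjoint edges, and $V(M)$ is the set of vertices it covers. For a graph $X$, the $q$-th squarefree power $I(X)^{[q]}$ is the ideal, in the polynomial ring over $\Bbbk$ whose variables are the vertices of $X$, generated by all monomials $\prod_{u\in V(M)}u$ with $M$ a $q$-matching of $X$. *)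

theory Defs
  imports
    "HOL-Algebra.QuotRing"
    "HOL-Library.Poly_Mapping"
    "HOL-Library.Extended_Real"
begin

section \<open>Krull dimension and height\<close>

definition prime_chain :: "('a, 'b) ring_scheme \<Rightarrow> nat \<Rightarrow> (nat \<Rightarrow> 'a set) \<Rightarrow> bool" where
  "prime_chain R l P \<longleftrightarrow>
     (\<forall>i\<le>l. primeideal (P i) R) \<and> (\<forall>i<l. P i \<subset> P (Suc i))"

text \<open>
  The suprema and infima are taken in \<^typ>\<open>ereal\<close>: the zero ring has dimension
  \<open>-\<infinity>\<close>, and the unit ideal has height \<open>\<infinity>\<close>.
\<close>

definition krull_dim :: "('a, 'b) ring_scheme \<Rightarrow> ereal" where
  "krull_dim R = (SUP l \<in> {l. \<exists>P. prime_chain R l P}. ereal (real l))"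

definition prime_height :: "('a, 'b) ring_scheme \<Rightarrow> 'a set \<Rightarrow> ereal" where
  "prime_height R Q = (SUP l \<in> {l. \<exists>P. prime_chain R l P \<and> P l = Q}. ereal (real l))"

definition ideal_height :: "('a, 'b) ring_scheme \<Rightarrow> 'a set \<Rightarrow> ereal" where
  "ideal_height R I = (INF Q \<in> {Q. primeideal Q R \<and> I \<subseteq> Q}. prime_height R Q)"


section \<open>Polynomial rings with a prescribed set of variables\<close>

text \<open>
  A monomial is a finitely supported exponent vector \<^typ>\<open>'v \<Rightarrow>\<^sub>0 nat\<close>; the
  multiplication of \<^typ>\<open>('v \<Rightarrow>\<^sub>0 nat) \<Rightarrow>\<^sub>0 'k\<close> is convolution.
\<close>

type_synonym ('v, 'k) mpoly = "('v \<Rightarrow>\<^sub>0 nat) \<Rightarrow>\<^sub>0 'k"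

definition mpoly_ring :: "'v set \<Rightarrow> ('v, 'k::comm_ring_1) mpoly ring" where
  "mpoly_ring V =
     \<lparr>carrier = {p. \<forall>m \<in> Poly_Mapping.keys p. Poly_Mapping.keys m \<subseteq> V},
      monoid.mult = (*), one = 1, ring.zero = 0, add = (+)\<rparr>"

definition mvar :: "'v \<Rightarrow> ('v, 'k::comm_ring_1) mpoly" where
  "mvar u = Poly_Mapping.single (Poly_Mapping.single u 1) 1"

lemma mpoly_ring_simps [simp]:
  "p \<in> carrier (mpoly_ring V) \<longleftrightarrow> (\<forall>m \<in> Poly_Mapping.keys p. Poly_Mapping.keys m \<subseteq> V)"
  "p \<otimes>\<^bsub>mpoly_ring V\<^esub> q = p * q" "\<one>\<^bsub>mpoly_ring V\<^esub> = 1"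
  "p \<oplus>\<^bsub>mpoly_ring V\<^esub> q = p + q" "\<zero>\<^bsub>mpoly_ring V\<^esub> = 0"
  by (simp_all add: mpoly_ring_def)

lemma mpoly_ring_add_closed:
  assumes "p \<in> carrier (mpoly_ring V)" "q \<in> carrier (mpoly_ring V)"
  shows "p + q \<in> carrier (mpoly_ring V)"
  using assms Poly_Mapping.keys_add[of p q] by fastforce

lemma mpoly_ring_mult_closed:
  assumes "p \<in> carrier (mpoly_ring V)" "q \<in> carrier (mpoly_ring V)"
  shows "p * q \<in> carrier (mpoly_ring V)"
  unfolding mpoly_ring_simps
proof
  fix m assume "m \<in> Poly_Mapping.keys (p * q)"
  then obtain a b where m: "m = a + b" and "a \<in> Poly_Mapping.keys p" "b \<in> Poly_Mapping.keys q"
    using Poly_Mapping.keys_mult[of p q] by blast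
  then have "Poly_Mapping.keys a \<subseteq> V" "Poly_Mapping.keys b \<subseteq> V"
    using assms by simp_all
  then show "Poly_Mapping.keys m \<subseteq> V"
    unfolding m using Poly_Mapping.keys_add[of a b] by (meson Un_least order_trans)
qed

lemma cring_mpoly_ring: "cring (mpoly_ring V :: ('v, 'k::comm_ring_1) mpoly ring)"
proof (rule cringI)
  show "abelian_group (mpoly_ring V :: ('v, 'k) mpoly ring)"
  proof (rule abelian_groupI)
    fix x assume "x \<in> carrier (mpoly_ring V :: ('v, 'k) mpoly ring)"
    then show "\<exists>y\<in>carrier (mpoly_ring V). y \<oplus>\<^bsub>mpoly_ring V\<^esub> x = \<zero>\<^bsub>mpoly_ring V\<^esub>"
      by (intro bexI[of _ "- x"]) simp_all
  qed (simp_all only: mpoly_ring_simps(2-5) mpoly_ring_add_closed add.assoc add.commute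
        add_0_left, simp_all)
  show "Group.comm_monoid (mpoly_ring V :: ('v, 'k) mpoly ring)"
  proof (rule comm_monoidI)
    show "\<one>\<^bsub>mpoly_ring V\<^esub> \<in> carrier (mpoly_ring V :: ('v, 'k) mpoly ring)"
      by (simp add: keys_one)
  qed (simp_all only: mpoly_ring_simps(2-5) mpoly_ring_mult_closed ac_simps
        mult_1_left mult_1_right)
qed (simp_all only: mpoly_ring_simps(2-5) distrib_right)


section \<open>Graphs, matchings and squarefree powers\<close>

record 'v ugraph =
  verts :: "'v set"
  edges :: "'v set set"

definition simple_graph :: "'v ugraph \<Rightarrow> bool" where
  "simple_graph X \<longleftrightarrow> finite (verts X) \<and> (\<forall>e \<in> edges X. e \<subseteq> verts X \<and> card e = 2)"

definition q_matching :: "'v ugraph \<Rightarrow> nat \<Rightarrow> 'v set set \<Rightarrow> bool" where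
  "q_matching X q M \<longleftrightarrow> M \<subseteq> edges X \<and> finite M \<and> card M = q \<and> pairwise disjnt M"

text \<open>The vertices covered by a matching \<open>M\<close> are \<open>\<Union>M\<close>.\<close>

definition squarefree_power :: "'v ugraph \<Rightarrow> nat \<Rightarrow> ('v, 'k::comm_ring_1) mpoly set" where
  "squarefree_power X q =
     Idl\<^bsub>mpoly_ring (verts X)\<^esub> {(\<Prod>u \<in> \<Union>M. mvar u) | M. q_matching X q M}"


section \<open>Wheel graphs\<close>

datatype wheel_vertex = Rim nat | Hub

definition wheel :: "nat \<Rightarrow> wheel_vertex ugraph" where
  "wheel n =
     \<lparr>verts = Rim ` {1..n} \<union> {Hub},
      edges = {{Rim i, Rim (Suc i)} | i. 1 \<le> i \<and> i < n} \<union> {{Rim n, Rim 1}}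
            \<union> {{Hub, Rim i} | i. 1 \<le> i \<and> i \<le> n}\<rparr>"

lemma simple_graph_wheel: "n \<ge> 3 \<Longrightarrow> simple_graph (wheel n)"
  by (auto simp: simple_graph_def wheel_def)

lemma card_verts_wheel: "card (verts (wheel n)) = n + 1"
proof -
  have "card (Rim ` {1..n}) = n" by (simp add: card_image inj_on_def)
  moreover have "Hub \<notin> Rim ` {1..n}" by blast
  ultimately show ?thesis by (simp add: wheel_def)
qed

end

theory Submission
  imports Defs "HOL-Library.FuncSet"
begin

text \<open>
  The ideal \<open>I\<close> is generated by squarefree monomials, so a prime that contains \<open>I\<close>
  contains a variable from each of them: the variables outside such a prime form a set
  of vertices within which there is no \<open>q\<close>-matching. Conversely, if there is no
  \<open>q\<close>-matching within \<open>F\<close>, the variables outside \<open>F\<close> generate a prime that contains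
  \<open>I\<close>. Hence \<open>dim R/I\<close> is the largest size \<open>d\<close> of a set of vertices
  within which there is no \<open>q\<close>-matching, and the height of \<open>I\<close> is the number of vertices
  minus \<open>d\<close>; this is \<open>squarefree_monomial_ideal_dimension\<close>.

  The lower bounds on dimension and height come from chains of ideals generated by variables.
  Both upper bounds come from \<open>prime_chain_length_le\<close>: a chain of primes of
  \<open>\<Bbbk>[V]\<close> whose first member contains the variables in \<open>C\<close> has length at
  most \<open>|V - C|\<close>. Elements \<open>y\<^sub>i\<close> that witness the strict inclusions of a longer
  chain would satisfy an algebraic relation, because there are more power products of bounded
  degree in them than monomials to express them. Read from its lexicographically least term, this
  relation forces a nonzero constant into the last prime: \<open>y\<^sub>0\<close> lies outside the first
  prime, so its lowest power can be cancelled there, and the terms that still contain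
  \<open>y\<^sub>0\<close> vanish modulo the second prime; then \<open>y\<^sub>1\<close> is treated alike, and
  so on.

  What remains is that \<open>d = \<lfloor>n/2\<rfloor> + q - 1\<close> for the wheel. A larger set
  contains both ends of many of the \<open>\<lfloor>n/2\<rfloor>\<close> edges of a maximum matching of the
  rim, by the pigeonhole principle, and the hub can be matched with a vertex left over
  (\<open>wheel_matching_in_large_set\<close>). The bound is attained by \<open>\<lfloor>n/2\<rfloor>\<close>
  independent rim vertices together with \<open>q - 1\<close> further ones, which meet every edge
  inside the set (\<open>wheel_large_set_without_matching\<close>).
\<close>


section \<open>Prime ideals of a quotient ring\<close>

text \<open>
  An ideal of \<open>R Quot I\<close> is a set of cosets, so its preimage in \<open>R\<close> is its union.
\<close>

lemma (in cring) primeideal_vimage_quot: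
  assumes I: "ideal I R" and J: "primeideal J (R Quot I)"
  shows "primeideal (\<Union>J) R" "I \<subseteq> \<Union>J" "(+>) I ` (\<Union>J) = J"
proof -
  have J': "ideal J (R Quot I)"
    using J by (simp add: primeideal_def)
  then have sub: "J \<subseteq> carrier (R Quot I)"
    by (simp add: additive_subgroup.a_subset ideal.axioms(1))
  have "\<Union>J = {r \<in> carrier R. I +> r \<in> J}"
    using canonical_proj_vimage_in_carrier[OF I sub] canonical_proj_vimage_mem_iff[OF I sub] by blast
  then show "primeideal (\<Union>J) R"
    using ring_hom_ring.primeideal_vimage[OF ideal.rcos_ring_hom_ring[OF I] is_cring J] by simp
  have "I \<in> J"
    using additive_subgroup.zero_closed[OF ideal.axioms(1)[OF J']] by (simp add: FactRing_def)
  then show "I \<subseteq> \<Union>J" by blast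
  obtain K where "ideal K R" "I \<subseteq> K" "J = (+>) I ` K"
    using quot_ideal_correspondence[OF I] J' unfolding bij_betw_def by blast
  moreover from this have "\<Union>J = K"
    using ideal_incl_iff[OF I] by blast
  ultimately show "(+>) I ` (\<Union>J) = J" by simp
qed

lemma (in cring) primeideal_image_quot:
  assumes I: "ideal I R" and J: "primeideal J R" and sub: "I \<subseteq> J"
  shows "primeideal ((+>) I ` J) (R Quot I)" "\<Union>((+>) I ` J) = J"
proof -
  have J': "ideal J R"
    using J by (simp add: primeideal_def)
  show un: "\<Union>((+>) I ` J) = J"
    using ideal_incl_iff[OF I J'] sub by blast
  have J'': "ideal ((+>) I ` J) (R Quot I)"
    using I J' by (rule ring_ideal_imp_quot_ideal)
  then have car: "(+>) I ` J \<subseteq> carrier (R Quot I)"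
    by (simp add: additive_subgroup.a_subset ideal.axioms(1))
  have mem: "I +> a \<in> (+>) I ` J \<longleftrightarrow> a \<in> J" if "a \<in> carrier R" for a
    using canonical_proj_vimage_mem_iff[OF I car that] un by simp
  have repr: "\<exists>r\<in>carrier R. x = I +> r" if "x \<in> carrier (R Quot I)" for x
    using that unfolding FactRing_def A_RCOSETS_def'[of R I] by auto
  show "primeideal ((+>) I ` J) (R Quot I)"
  proof (rule primeidealI[OF J'' ideal.quotient_is_cring[OF I is_cring]])
    have "\<one> \<notin> J"
      using J J' primeideal.I_notcarr ideal.one_imp_carrier by blast
    then have "I +> \<one> \<notin> (+>) I ` J" by (simp add: mem)
    moreover have "I +> \<one> \<in> carrier (R Quot I)"
      using ring_hom_closed[OF ideal.rcos_ring_hom[OF I] one_closed] .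
    ultimately show "carrier (R Quot I) \<noteq> (+>) I ` J" by blast
  next
    fix a b
    assume "a \<in> carrier (R Quot I)" "b \<in> carrier (R Quot I)"
      and ab: "a \<otimes>\<^bsub>R Quot I\<^esub> b \<in> (+>) I ` J"
    then obtain x y where xy: "x \<in> carrier R" "a = I +> x" "y \<in> carrier R" "b = I +> y"
      using repr by metis
    then have "a \<otimes>\<^bsub>R Quot I\<^esub> b = I +> (x \<otimes> y)"
      using ideal.rcoset_mult_add[OF I] by (simp add: FactRing_def)
    with ab xy have "x \<otimes> y \<in> J" by (simp add: mem)
    then have "x \<in> J \<or> y \<in> J"
      using primeideal.I_prime[OF J] xy by blast
    then show "a \<in> (+>) I ` J \<or> b \<in> (+>) I ` J"
      using xy by (simp add: mem)
  qed
qed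

text \<open>
  Preimage and image under the projection preserve primality and strict inclusion, so chains of
  primes of the quotient correspond to chains of primes of \<open>R\<close> that start above \<open>I\<close>.
\<close>

lemma krull_dim_quot:
  assumes R: "cring R" and I: "ideal I R"
  shows "krull_dim (R Quot I) = (SUP l \<in> {l. \<exists>P. prime_chain R l P \<and> I \<subseteq> P 0}. ereal (real l))"
proof -
  interpret cring R by fact
  have "(\<exists>P. prime_chain (R Quot I) l P) \<longleftrightarrow> (\<exists>P. prime_chain R l P \<and> I \<subseteq> P 0)" for l
  proof
    assume "\<exists>P. prime_chain (R Quot I) l P"
    then obtain P where P: "\<And>i. i \<le> l \<Longrightarrow> primeideal (P i) (R Quot I)"
        "\<And>i. i < l \<Longrightarrow> P i \<subset> P (Suc i)"
      unfolding prime_chain_def by blast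
    note vimage = primeideal_vimage_quot[OF I P(1)]
    have "\<Union>(P i) \<noteq> \<Union>(P (Suc i))" if "i < l" for i
      using vimage(3)[of i] vimage(3)[of "Suc i"] P(2)[OF that] that by (metis Suc_leI nless_le)
    then have "prime_chain R l (\<lambda>i. \<Union>(P i))"
      unfolding prime_chain_def using vimage(1) P(2) by (simp add: psubset_eq Union_mono)
    moreover have "I \<subseteq> \<Union>(P 0)" using vimage(2) by simp
    ultimately show "\<exists>P. prime_chain R l P \<and> I \<subseteq> P 0"
      by (intro exI[of _ "\<lambda>i. \<Union>(P i)"]) simp
  next
    assume "\<exists>P. prime_chain R l P \<and> I \<subseteq> P 0"
    then obtain P where P: "\<And>i. i \<le> l \<Longrightarrow> primeideal (P i) R"
        "\<And>i. i < l \<Longrightarrow> P i \<subset> P (Suc i)" and "I \<subseteq> P 0"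
      unfolding prime_chain_def by blast
    have sub: "I \<subseteq> P i" if "i \<le> l" for i
      using that by (induction i) (use \<open>I \<subseteq> P 0\<close> P(2) in \<open>auto simp: Suc_le_eq\<close>)
    note image = primeideal_image_quot[OF I P(1) sub]
    have "(+>\<^bsub>R\<^esub>) I ` P i \<noteq> (+>\<^bsub>R\<^esub>) I ` P (Suc i)" if "i < l" for i
      using image(2)[of i] image(2)[of "Suc i"] P(2)[OF that] that
      by (metis Suc_leI less_imp_le nless_le)
    then have "prime_chain (R Quot I) l (\<lambda>i. (+>\<^bsub>R\<^esub>) I ` P i)"
      unfolding prime_chain_def using image(1) P(2) by (simp add: psubset_eq image_mono)
    then show "\<exists>P. prime_chain (R Quot I) l P" by blast
  qed
  then show ?thesis by (simp add: krull_dim_def)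
qed


section \<open>Ideals generated by variables\<close>

lemma mpoly_eq_sum_monomials:
  "p = (\<Sum>m\<in>Poly_Mapping.keys p. Poly_Mapping.single m (Poly_Mapping.lookup p m))"
  by (rule poly_mapping_eqI)
    (simp add: lookup_sum lookup_single when_def sum.delta in_keys_iff)

lemma sum_in_mpoly_ideal:
  assumes P: "ideal P (mpoly_ring V)" and "\<And>x. x \<in> A \<Longrightarrow> f x \<in> P"
  shows "sum f A \<in> P"
proof -
  have "a + b \<in> P" if "a \<in> P" "b \<in> P" for a b
    using additive_subgroup.a_closed[OF ideal.axioms(1)[OF P]] that by simp
  then show ?thesis
    using assms(2) additive_subgroup.zero_closed[OF ideal.axioms(1)[OF P]]
    by (induction A rule: infinite_finite_induct) simp_all
qed

lemma mpoly_ideal_mult: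
  assumes P: "ideal P (mpoly_ring V)" and "a \<in> P" "r \<in> carrier (mpoly_ring V)"
  shows "r * a \<in> P"
  using ideal.I_l_closed[OF P] assms by (simp only: mpoly_ring_simps)

lemma mpoly_ideal_minus:
  assumes P: "ideal P (mpoly_ring V)" and "a \<in> P" "b \<in> P"
  shows "a - b \<in> (P :: ('v, 'k::comm_ring_1) mpoly set)"
proof -
  have "- 1 * b \<in> P"
    by (rule mpoly_ideal_mult[OF P \<open>b \<in> P\<close>]) simp
  then have "a + - 1 * b \<in> P"
    using additive_subgroup.a_closed[OF ideal.axioms(1)[OF P] \<open>a \<in> P\<close>] by (simp only: mpoly_ring_simps)
  then show ?thesis by (simp only: mult_minus1 add_uminus_conv_diff)
qed

lemma mvar_in_mpoly_ring: "u \<in> V \<Longrightarrow> mvar u \<in> carrier (mpoly_ring V)"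
  by (simp add: mvar_def)

text \<open>
  This is the ideal of \<open>\<Bbbk>[V]\<close> generated by the variables in \<open>V \<inter> C\<close>. Describing it by
  its monomials makes membership decidable term by term.
\<close>

definition var_ideal :: "'v set \<Rightarrow> 'v set \<Rightarrow> ('v, 'k::comm_ring_1) mpoly set" where
  "var_ideal V C = {p \<in> carrier (mpoly_ring V). \<forall>m \<in> Poly_Mapping.keys p. Poly_Mapping.keys m \<inter> C \<noteq> {}}"

lemma var_ideal_ideal: "ideal (var_ideal V C) (mpoly_ring V :: ('v, 'k::comm_ring_1) mpoly ring)"
proof -
  interpret cring "mpoly_ring V :: ('v, 'k) mpoly ring" by (rule cring_mpoly_ring)
  let ?R = "mpoly_ring V :: ('v, 'k) mpoly ring"
  have neg: "inv\<^bsub>add_monoid ?R\<^esub> a = - a" if "a \<in> carrier ?R" for a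
  proof -
    have "\<ominus>\<^bsub>?R\<^esub> a = - a"
      using that by (intro minus_equality) simp_all
    then show ?thesis by (simp add: a_inv_def)
  qed
  have mult: "r * a \<in> var_ideal V C" if "a \<in> var_ideal V C" "r \<in> carrier ?R" for a r
  proof -
    have "Poly_Mapping.keys m \<inter> C \<noteq> {}" if m: "m \<in> Poly_Mapping.keys (r * a)" for m
    proof -
      obtain s t where "m = s + t" "t \<in> Poly_Mapping.keys a"
        using keys_mult[of r a] m by blast
      moreover have "Poly_Mapping.keys t \<subseteq> Poly_Mapping.keys (s + t)"
        by (auto simp: in_keys_iff lookup_add)
      ultimately show ?thesis
        using \<open>a \<in> var_ideal V C\<close> unfolding var_ideal_def by blast
    qed
    moreover have "r * a \<in> carrier ?R"
      using that mpoly_ring_mult_closed unfolding var_ideal_def by blast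
    ultimately show ?thesis by (simp add: var_ideal_def)
  qed
  show ?thesis
  proof (rule idealI[OF ring_axioms])
    show "subgroup (var_ideal V C) (add_monoid ?R)"
    proof (unfold_locales)
      fix x y :: "('v, 'k) mpoly" assume "x \<in> var_ideal V C" "y \<in> var_ideal V C"
      then show "x \<otimes>\<^bsub>add_monoid ?R\<^esub> y \<in> var_ideal V C"
        using keys_add[of x y] mpoly_ring_add_closed[of x V y]
        unfolding var_ideal_def by (simp del: mpoly_ring_simps(1)) blast
    next
      fix x :: "('v, 'k) mpoly" assume "x \<in> var_ideal V C"
      then show "inv\<^bsub>add_monoid ?R\<^esub> x \<in> var_ideal V C"
        using neg by (auto simp: var_ideal_def)
    qed (auto simp: var_ideal_def)
  next
    fix a x :: "('v, 'k) mpoly" assume "a \<in> var_ideal V C" "x \<in> carrier ?R"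
    then show "x \<otimes>\<^bsub>?R\<^esub> a \<in> var_ideal V C" "a \<otimes>\<^bsub>?R\<^esub> x \<in> var_ideal V C"
      using mult by (simp_all add: mult.commute del: mpoly_ring_simps(1))
  qed
qed

text \<open>
  Collecting the monomials that avoid \<open>C\<close> gives the normal form of a polynomial modulo the
  variables in \<open>C\<close>.
\<close>

lemma var_ideal_complement:
  assumes "p \<in> carrier (mpoly_ring V)"
  obtains r s where "p = r + s" "r \<in> carrier (mpoly_ring (V - C))" "s \<in> var_ideal V C"
proof
  let ?f = "\<lambda>m. Poly_Mapping.single m (Poly_Mapping.lookup p m)"
  let ?A = "{m \<in> Poly_Mapping.keys p. Poly_Mapping.keys m \<inter> C = {}}"
  have "p = sum ?f (Poly_Mapping.keys p)" by (rule mpoly_eq_sum_monomials)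
  also have "\<dots> = sum ?f ?A + sum ?f (Poly_Mapping.keys p - ?A)"
    by (subst add.commute, rule sum.subset_diff) auto
  finally show "p = sum ?f ?A + sum ?f (Poly_Mapping.keys p - ?A)" .
  show "sum ?f ?A \<in> carrier (mpoly_ring (V - C))"
    using keys_sum[of ?f ?A] assms by (fastforce split: if_splits)
  show "sum ?f (Poly_Mapping.keys p - ?A) \<in> var_ideal V C"
    using keys_sum[of ?f "Poly_Mapping.keys p - ?A"] assms
    by (fastforce simp: var_ideal_def split: if_splits)
qed

text \<open>
  Each monomial of an element is a multiple of some variable in \<open>C\<close>.
\<close>

lemma var_ideal_least:
  assumes P: "ideal P (mpoly_ring V)" and C: "\<And>u. u \<in> C \<Longrightarrow> mvar u \<in> P"
  shows "var_ideal V C \<subseteq> (P :: ('v, 'k::comm_ring_1) mpoly set)"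
proof
  fix p :: "('v, 'k) mpoly" assume p: "p \<in> var_ideal V C"
  have "Poly_Mapping.single m (Poly_Mapping.lookup p m) \<in> P" if m: "m \<in> Poly_Mapping.keys p" for m
  proof -
    obtain u where u: "u \<in> Poly_Mapping.keys m" "u \<in> C"
      using p m unfolding var_ideal_def by blast
    \<comment> \<open>the monomial \<open>m\<close> divided by the variable \<open>u\<close>\<close>
    define m' where "m' = m - Poly_Mapping.single u 1"
    have m_eq: "m = m' + Poly_Mapping.single u 1"
      using u unfolding m'_def
      by (intro poly_mapping_eqI)
        (auto simp: lookup_add lookup_minus lookup_single when_def in_keys_iff)
    have "Poly_Mapping.keys m' \<subseteq> Poly_Mapping.keys m"
      unfolding m_eq by (auto simp: in_keys_iff lookup_add)
    then have "Poly_Mapping.single m' (Poly_Mapping.lookup p m) \<in> carrier (mpoly_ring V)"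
      using p m unfolding var_ideal_def by (auto split: if_splits)
    from mpoly_ideal_mult[OF P C[OF u(2)] this] show ?thesis
      by (simp add: mvar_def mult_single flip: m_eq One_nat_def)
  qed
  then show "p \<in> P"
    by (subst mpoly_eq_sum_monomials) (rule sum_in_mpoly_ideal[OF P])
qed

lemma mvar_in_var_ideal_iff: "mvar u \<in> var_ideal V C \<longleftrightarrow> u \<in> V \<and> u \<in> C"
  by (auto simp: var_ideal_def mvar_def)

lemma var_ideal_psubset:
  assumes "C \<subset> D" "D \<subseteq> V"
  shows "var_ideal V C \<subset> (var_ideal V D :: ('v, 'k::comm_ring_1) mpoly set)"
proof -
  obtain u where "u \<in> D" "u \<notin> C" using assms by blast
  then have "(mvar u :: ('v, 'k) mpoly) \<in> var_ideal V D - var_ideal V C"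
    using assms by (auto simp: mvar_in_var_ideal_iff)
  moreover have "var_ideal V C \<subseteq> (var_ideal V D :: ('v, 'k) mpoly set)"
    using assms unfolding var_ideal_def by blast
  ultimately show ?thesis by blast
qed

text \<open>
  The quotient is the domain \<open>\<Bbbk>[V - C]\<close>: replacing two polynomials by their normal forms
  changes their product by an element of the ideal, and a product of normal forms again avoids
  \<open>C\<close>. The linear order on the variables induces one on the monomials; comparing leading
  terms then shows that polynomials have no zero divisors.
\<close>

lemma primeideal_var_ideal:
  "primeideal (var_ideal V C) (mpoly_ring V :: ('v::linorder, 'k::idom) mpoly ring)"
proof (rule primeidealI[OF var_ideal_ideal cring_mpoly_ring])
  have "(1 :: ('v, 'k) mpoly) \<in> carrier (mpoly_ring V) - var_ideal V C"
    by (simp add: var_ideal_def)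
  then show "carrier (mpoly_ring V) \<noteq> (var_ideal V C :: ('v, 'k) mpoly set)" by blast
next
  fix a b :: "('v, 'k) mpoly"
  assume ab: "a \<in> carrier (mpoly_ring V)" "b \<in> carrier (mpoly_ring V)"
    and "a \<otimes>\<^bsub>mpoly_ring V\<^esub> b \<in> var_ideal V C"
  obtain r s where a: "a = r + s" and r: "r \<in> carrier (mpoly_ring (V - C))" and s: "s \<in> var_ideal V C"
    using var_ideal_complement[OF ab(1)] .
  obtain r' s' where b: "b = r' + s'" and r': "r' \<in> carrier (mpoly_ring (V - C))"
    and s': "s' \<in> var_ideal V C"
    using var_ideal_complement[OF ab(2)] .
  note I = var_ideal_ideal[of V C, where 'k = 'k]
  have "r * r' = a * b - (a * s' + r' * s)"
    by (simp add: a b algebra_simps)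
  also have "\<dots> \<in> var_ideal V C"
  proof -
    have "r' \<in> carrier (mpoly_ring V)" using r' by auto
    then have "a * s' \<in> var_ideal V C" "r' * s \<in> var_ideal V C"
      using mpoly_ideal_mult[OF I] s s' ab by blast+
    then have "a * s' + r' * s \<in> var_ideal V C"
      using additive_subgroup.a_closed[OF ideal.axioms(1)[OF I]] by simp
    then show ?thesis
      using mpoly_ideal_minus[OF I] \<open>a \<otimes>\<^bsub>mpoly_ring V\<^esub> b \<in> var_ideal V C\<close> by simp
  qed
  finally have rr': "r * r' \<in> var_ideal V C" .
  moreover have "r * r' \<in> carrier (mpoly_ring (V - C))"
    using r r' by (rule mpoly_ring_mult_closed)
  ultimately have "Poly_Mapping.keys (r * r') = {}"
    unfolding var_ideal_def by fastforce
  then have "r = 0 \<or> r' = 0" by simp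
  then show "a \<in> var_ideal V C \<or> b \<in> var_ideal V C"
    using a b s s' by auto
qed


section \<open>Algebraic dependence\<close>

text \<open>
  Bounding the degree in each variable, rather than the total degree, makes the bounded monomials
  simple to count.
\<close>

definition deg_le :: "'v set \<Rightarrow> nat \<Rightarrow> ('v, 'k::comm_ring_1) mpoly set" where
  "deg_le V B = {p \<in> carrier (mpoly_ring V). \<forall>m \<in> Poly_Mapping.keys p. \<forall>v. Poly_Mapping.lookup m v \<le> B}"

lemma ex_deg_le:
  assumes "p \<in> carrier (mpoly_ring V)"
  shows "\<exists>B. p \<in> deg_le V B"
proof
  let ?S = "(\<Union>m\<in>Poly_Mapping.keys p. Poly_Mapping.lookup m ` Poly_Mapping.keys m)"
  have "Poly_Mapping.lookup m v \<le> Max (insert 0 ?S)" if "m \<in> Poly_Mapping.keys p" for m v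
  proof (cases "v \<in> Poly_Mapping.keys m")
    case True
    then have "Poly_Mapping.lookup m v \<in> insert 0 ?S" using that by blast
    then show ?thesis by (intro Max_ge) simp_all
  qed (simp add: in_keys_iff)
  then show "p \<in> deg_le V (Max (insert 0 ?S))"
    using assms by (simp add: deg_le_def)
qed

lemma deg_le_mono: "B \<le> B' \<Longrightarrow> deg_le V B \<subseteq> deg_le V B'"
  unfolding deg_le_def using order_trans by blast

lemma deg_le_mult:
  assumes "p \<in> deg_le V A" "q \<in> deg_le V B"
  shows "p * q \<in> deg_le V (A + B)"
proof -
  have "p * q \<in> carrier (mpoly_ring V)"
    using assms mpoly_ring_mult_closed unfolding deg_le_def by blast
  moreover have "Poly_Mapping.lookup m v \<le> A + B" if m: "m \<in> Poly_Mapping.keys (p * q)" for m v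
  proof -
    obtain s t where "m = s + t" "s \<in> Poly_Mapping.keys p" "t \<in> Poly_Mapping.keys q"
      using keys_mult[of p q] m by blast
    then show ?thesis using assms by (simp add: deg_le_def lookup_add add_mono)
  qed
  ultimately show ?thesis by (simp add: deg_le_def)
qed

lemma deg_le_power: "p \<in> deg_le V A \<Longrightarrow> p ^ k \<in> deg_le V (A * k)"
proof (induction k)
  case (Suc k)
  then show ?case using deg_le_mult[of p V A "p ^ k" "A * k"] by simp
qed (simp add: deg_le_def)

lemma deg_le_prod:
  assumes "\<And>i. i \<in> S \<Longrightarrow> f i \<in> deg_le V A"
  shows "prod f S \<in> deg_le V (A * card S)"
  using assms
proof (induction S rule: infinite_finite_induct)
  case (insert x F)
  then show ?case using deg_le_mult[of "f x" V A "prod f F" "A * card F"] by simp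
qed (simp_all add: deg_le_def)

definition bounded_monomials :: "'v set \<Rightarrow> nat \<Rightarrow> ('v \<Rightarrow>\<^sub>0 nat) set" where
  "bounded_monomials V B = {m. Poly_Mapping.keys m \<subseteq> V \<and> (\<forall>v. Poly_Mapping.lookup m v \<le> B)}"

lemma bounded_monomials_card:
  assumes "finite V"
  shows "finite (bounded_monomials V B)" "card (bounded_monomials V B) \<le> (B + 1) ^ card V"
proof -
  let ?f = "\<lambda>m. restrict (Poly_Mapping.lookup m) V"
  have inj: "inj_on ?f (bounded_monomials V B)"
  proof (rule inj_onI)
    fix m m' assume m: "m \<in> bounded_monomials V B" "m' \<in> bounded_monomials V B" and eq: "?f m = ?f m'"
    show "m = m'"
    proof (rule poly_mapping_eqI)
      fix v
      show "Poly_Mapping.lookup m v = Poly_Mapping.lookup m' v"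
      proof (cases "v \<in> V")
        case True
        then show ?thesis using fun_cong[OF eq, of v] by simp
      next
        case False
        then show ?thesis using m unfolding bounded_monomials_def
          by (metis (mono_tags, lifting) in_keys_iff mem_Collect_eq subsetD)
      qed
    qed
  qed
  moreover have sub: "?f ` bounded_monomials V B \<subseteq> V \<rightarrow>\<^sub>E {..B}"
    by (auto simp: bounded_monomials_def)
  moreover have fin: "finite (V \<rightarrow>\<^sub>E {..B})"
    using assms by (simp add: finite_PiE)
  ultimately show "finite (bounded_monomials V B)"
    using finite_imageD finite_subset by blast
  have "card (bounded_monomials V B) \<le> card (V \<rightarrow>\<^sub>E {..B})"
    using card_inj_on_le[OF inj sub fin] .
  then show "card (bounded_monomials V B) \<le> (B + 1) ^ card V"
    using assms by (simp add: card_PiE)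
qed

interpretation mpoly: vector_space "\<lambda>c p. Poly_Mapping.single 0 (c::'k::field) * (p :: ('v, 'k) mpoly)"
  by unfold_locales (simp_all add: algebra_simps single_add mult_single flip: mult.assoc)

lemma deg_le_subset_span:
  "deg_le V B \<subseteq> mpoly.span ((\<lambda>m. Poly_Mapping.single m 1) ` bounded_monomials V B)"
proof
  fix p :: "('a, 'b::field) mpoly" assume p: "p \<in> deg_le V B"
  have "(\<Sum>m\<in>Poly_Mapping.keys p. Poly_Mapping.single m (Poly_Mapping.lookup p m))
      \<in> mpoly.span ((\<lambda>m. Poly_Mapping.single m 1) ` bounded_monomials V B)"
  proof (rule mpoly.span_sum)
    fix m assume "m \<in> Poly_Mapping.keys p"
    then have "m \<in> bounded_monomials V B"
      using p by (auto simp: bounded_monomials_def deg_le_def)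
    then have "Poly_Mapping.single 0 (Poly_Mapping.lookup p m) * Poly_Mapping.single m 1
        \<in> mpoly.span ((\<lambda>m. Poly_Mapping.single m 1) ` bounded_monomials V B)"
      by (intro mpoly.span_scale mpoly.span_base) blast
    then show "Poly_Mapping.single m (Poly_Mapping.lookup p m)
        \<in> mpoly.span ((\<lambda>m. Poly_Mapping.single m 1) ` bounded_monomials V B)"
      by (simp add: mult_single)
  qed
  then show "p \<in> mpoly.span ((\<lambda>m. Poly_Mapping.single m 1) ` bounded_monomials V B)"
    by (simp flip: mpoly_eq_sum_monomials)
qed

text \<open>
  A counting argument replaces the theory of transcendence degree. If all \<open>y i\<close> have degree
  at most \<open>D\<close> in each variable, then the \<open>m ^ l\<close> products of powers of the \<open>y i\<close>
  with exponents below \<open>m\<close> lie in a space of dimension at most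
  \<open>(D * m * l + 1) ^ card V\<close>, which is smaller for large \<open>m\<close> because
  \<open>card V < l\<close>. The exponent functions are required to be extensional so that distinct
  ones give distinct terms of the relation.
\<close>

lemma algebraically_dependent:
  fixes y :: "nat \<Rightarrow> ('v, 'k::field) mpoly"
  assumes V: "finite V" "card V < l" and y: "\<And>i. i < l \<Longrightarrow> y i \<in> carrier (mpoly_ring V)"
  obtains E c where "finite E" "E \<noteq> {}" "E \<subseteq> extensional {..<l}" "\<And>e. e \<in> E \<Longrightarrow> c e \<noteq> 0"
    "(\<Sum>e\<in>E. Poly_Mapping.single 0 (c e) * (\<Prod>i<l. y i ^ e i)) = 0"
proof -
  have "\<exists>B. \<forall>i<l. y i \<in> deg_le V B"
  proof -
    obtain b where b: "\<And>i. i < l \<Longrightarrow> y i \<in> deg_le V (b i)"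
      using ex_deg_le[OF y] by metis
    have "b i \<le> (\<Sum>i<l. b i)" if "i < l" for i
      using that by (intro member_le_sum) auto
    then show ?thesis using b deg_le_mono by blast
  qed
  then obtain D where D: "\<And>i. i < l \<Longrightarrow> y i \<in> deg_le V D" by blast
  \<comment> \<open>large enough that \<open>m ^ card V * (D * l + 1) ^ card V < m ^ Suc (card V)\<close>\<close>
  define m where "m = (D * l + 1) ^ card V + 1"
  define mono where "mono e = (\<Prod>i<l. y i ^ e i)" for e :: "nat \<Rightarrow> nat"
  define E0 where "E0 = ({..<l} \<rightarrow>\<^sub>E {..<m})"
  have E0: "finite E0" "card E0 = m ^ l"
    by (simp_all add: E0_def finite_PiE card_PiE)
  have deg: "mono ` E0 \<subseteq> deg_le V (D * m * l)"
  proof safe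
    fix e assume e: "e \<in> E0"
    have "y i ^ e i \<in> deg_le V (D * m)" if "i < l" for i
    proof -
      have "e i \<le> m" using e that by (auto simp: E0_def PiE_def Pi_def intro: less_imp_le)
      then show ?thesis
        using deg_le_power[OF D[OF that], of "e i"] deg_le_mono[of "D * e i" "D * m" V] by auto
    qed
    then show "mono e \<in> deg_le V (D * m * l)"
      using deg_le_prod[of "{..<l}" "\<lambda>i. y i ^ e i" V "D * m"] by (simp add: mono_def)
  qed
  let ?T = "(\<lambda>m. Poly_Mapping.single m (1::'k)) ` bounded_monomials V (D * m * l)"
  have T: "finite ?T" using bounded_monomials_card(1)[OF V(1)] by blast
  have "card ?T \<le> (D * m * l + 1) ^ card V"
    using card_image_le[OF bounded_monomials_card(1)[OF V(1)]] bounded_monomials_card(2)[OF V(1)] le_trans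
    by blast
  also have "\<dots> \<le> (m * (D * l + 1)) ^ card V"
    by (rule power_mono) (simp_all add: m_def algebra_simps)
  also have "\<dots> = m ^ card V * (D * l + 1) ^ card V"
    by (rule power_mult_distrib)
  also have "\<dots> < m ^ card V * m"
    by (simp add: m_def)
  also have "\<dots> \<le> m ^ l"
    using V(2) power_increasing[of "Suc (card V)" l m] by (simp add: m_def mult.commute)
  finally have small: "card ?T < m ^ l" .
  \<comment> \<open>linear dependence of a set of polynomials sees only distinct products; a coincidence
    of two products is a relation by itself\<close>
  show thesis
  proof (cases "inj_on mono E0")
    case True
    have "mpoly.dependent (mono ` E0)"
    proof (rule ccontr)
      assume "\<not> mpoly.dependent (mono ` E0)"
      then have "card (mono ` E0) \<le> card ?T"
        using mpoly.independent_span_bound[OF T] deg deg_le_subset_span by blast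
      then show False using small E0 card_image[OF True] by simp
    qed
    then obtain t u where t: "finite t" "t \<subseteq> mono ` E0"
        and sum: "(\<Sum>v\<in>t. Poly_Mapping.single 0 (u v) * v) = 0" and "\<exists>v\<in>t. u v \<noteq> 0"
      unfolding mpoly.dependent_explicit by blast
    define t' where "t' = {v \<in> t. u v \<noteq> 0}"
    define E where "E = {e \<in> E0. mono e \<in> t'}"
    have im: "mono ` E = t'" using t by (auto simp: E_def t'_def)
    have inj: "inj_on mono E" using True by (rule inj_on_subset) (auto simp: E_def)
    show thesis
    proof (rule that[of E "\<lambda>e. u (mono e)"])
      show "finite E" using E0 by (simp add: E_def)
      show "E \<noteq> {}" using im \<open>\<exists>v\<in>t. u v \<noteq> 0\<close> by (auto simp: t'_def)
      show "E \<subseteq> extensional {..<l}" by (auto simp: E_def E0_def PiE_def)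
      show "u (mono e) \<noteq> 0" if "e \<in> E" for e using that by (simp add: E_def t'_def)
      have "(\<Sum>e\<in>E. Poly_Mapping.single 0 (u (mono e)) * mono e)
          = (\<Sum>v\<in>t'. Poly_Mapping.single 0 (u v) * v)"
        unfolding im[symmetric] by (subst sum.reindex[OF inj]) simp
      also have "\<dots> = (\<Sum>v\<in>t. Poly_Mapping.single 0 (u v) * v)"
        using t by (intro sum.mono_neutral_left) (auto simp: t'_def)
      finally show "(\<Sum>e\<in>E. Poly_Mapping.single 0 (u (mono e)) * (\<Prod>i<l. y i ^ e i)) = 0"
        using sum by (simp add: mono_def)
    qed
  next
    case False
    then obtain e e' where e: "e \<in> E0" "e' \<in> E0" "e \<noteq> e'" "mono e = mono e'"
      unfolding inj_on_def by blast
    show thesis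
    proof (rule that[of "{e, e'}" "\<lambda>x. if x = e then 1 else - 1"])
      show "{e, e'} \<subseteq> extensional {..<l}" using e by (auto simp: E0_def PiE_def)
      show "(\<Sum>x\<in>{e, e'}. Poly_Mapping.single 0 (if x = e then 1 else - 1 :: 'k) * (\<Prod>i<l. y i ^ x i)) = 0"
        using e by (simp add: mono_def[symmetric] single_uminus)
    qed auto
  qed
qed


section \<open>Chains of primes in a polynomial ring\<close>

lemma mpoly_ring_power_closed:
  assumes "p \<in> carrier (mpoly_ring V)"
  shows "p ^ k \<in> carrier (mpoly_ring V)"
proof (induction k)
  case (Suc k)
  then show ?case using mpoly_ring_mult_closed[OF assms] by simp
qed simp

lemma mpoly_ring_prod_closed:
  assumes "\<And>i. i \<in> S \<Longrightarrow> f i \<in> carrier (mpoly_ring V)"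
  shows "prod f S \<in> carrier (mpoly_ring V)"
  using assms
proof (induction S rule: infinite_finite_induct)
  case (insert x F)
  then show ?case using mpoly_ring_mult_closed[of "f x" V "prod f F"] by (simp del: mpoly_ring_simps(1))
qed simp_all

lemma one_notin_primeideal:
  assumes "primeideal Q (mpoly_ring V)"
  shows "1 \<notin> Q"
proof -
  have "ideal Q (mpoly_ring V)" using assms by (simp add: primeideal_def)
  then show ?thesis
    using ideal.one_imp_carrier primeideal.I_notcarr[OF assms] by force
qed

lemma primeideal_multD:
  assumes "primeideal Q (mpoly_ring V)" "a \<in> carrier (mpoly_ring V)" "b \<in> carrier (mpoly_ring V)"
    and "a * b \<in> Q"
  shows "a \<in> Q \<or> b \<in> Q"
  using primeideal.I_prime[OF assms(1-3)] assms(4) by simp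

lemma primeideal_power_multD:
  assumes Q: "primeideal Q (mpoly_ring V)" and y: "y \<in> carrier (mpoly_ring V)" "y \<notin> Q"
    and w: "w \<in> carrier (mpoly_ring V)" and "y ^ k * w \<in> Q"
  shows "w \<in> Q"
  using assms(5)
proof (induction k)
  case (Suc k)
  have "y ^ k * w \<in> carrier (mpoly_ring V)"
    using mpoly_ring_mult_closed[OF mpoly_ring_power_closed[OF y(1)] w] .
  then have "y ^ k * w \<in> Q"
    using primeideal_multD[OF Q y(1)] Suc.prems y(2) by (simp add: mult.assoc)
  then show ?case by (rule Suc.IH)
qed simp

lemma primeideal_prodD:
  assumes Q: "primeideal Q (mpoly_ring V)"
    and "finite A" "\<And>u. u \<in> A \<Longrightarrow> f u \<in> carrier (mpoly_ring V)" "prod f A \<in> Q"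
  shows "\<exists>u\<in>A. f u \<in> Q"
  using assms(2-)
proof (induction A)
  case empty
  then show ?case using one_notin_primeideal[OF Q] by simp
next
  case (insert x F)
  have "f x \<in> Q \<or> prod f F \<in> Q"
    by (rule primeideal_multD[OF Q])
      (use insert mpoly_ring_prod_closed[of F f V] in \<open>simp_all del: mpoly_ring_simps\<close>)
  then show ?case using insert by blast
qed

lemma prime_chain_mono:
  assumes "prime_chain R l P" "i \<le> j" "j \<le> l"
  shows "P i \<subseteq> P j"
  using assms(2,3)
proof (induction j rule: dec_induct)
  case (step j)
  then show ?case using assms(1) by (force simp: prime_chain_def Suc_le_eq)
qed simp

text \<open>
  The strict inclusions of the chain are witnessed by elements \<open>y i\<close> of
  \<open>P (Suc i) - P i\<close>, which may be reduced modulo the variables in \<open>C\<close>, since these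
  lie in every prime of the chain. If there are more than \<open>card (V - C)\<close> of them, they satisfy
  a polynomial relation, and the proof shows by induction on \<open>j\<close> that the terms of the
  relation whose first \<open>j\<close> exponents are lexicographically least, divided by the powers
  of the first \<open>j\<close> elements, sum up to an element of \<open>P j\<close>. At the end of the
  chain a single term is left, a nonzero constant.
\<close>

lemma prime_chain_length_le:
  fixes P :: "nat \<Rightarrow> ('v, 'k::field) mpoly set"
  assumes V: "finite V" and chain: "prime_chain (mpoly_ring V) l P"
    and C: "\<And>u. u \<in> C \<Longrightarrow> mvar u \<in> P 0"
  shows "l \<le> card (V - C)"
proof (rule ccontr)
  assume "\<not> l \<le> card (V - C)"
  then have l: "card (V - C) < l" by simp
  have prime: "primeideal (P i) (mpoly_ring V)" if "i \<le> l" for i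
    using chain that by (simp add: prime_chain_def)
  have ideal: "ideal (P i) (mpoly_ring V)" if "i \<le> l" for i
    using prime[OF that] by (simp add: primeideal_def)
  have sub: "p \<in> carrier (mpoly_ring V)" if "p \<in> carrier (mpoly_ring (V - C))" for p :: "('v, 'k) mpoly"
    using that by auto
  have var0: "var_ideal V C \<subseteq> P 0"
    by (rule var_ideal_least[OF ideal C]) simp_all
  have "\<exists>r. r \<in> carrier (mpoly_ring (V - C)) \<and> r \<in> P (Suc i) - P i" if i: "i < l" for i
  proof -
    obtain z where z: "z \<in> P (Suc i)" "z \<notin> P i"
      using chain i unfolding prime_chain_def by blast
    then have "z \<in> carrier (mpoly_ring V)"
      using ideal[of "Suc i"] i ideal.Icarr by (metis Suc_leI)
    then obtain r s where rs: "z = r + s" "r \<in> carrier (mpoly_ring (V - C))" "s \<in> var_ideal V C"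
      by (rule var_ideal_complement)
    have s: "s \<in> P i" "s \<in> P (Suc i)"
      using rs(3) var0 prime_chain_mono[OF chain, of 0 i] prime_chain_mono[OF chain, of 0 "Suc i"] i
      by auto
    have "r \<in> P (Suc i)"
      using mpoly_ideal_minus[OF ideal z(1) s(2)] i rs(1) by simp
    moreover have "r \<notin> P i"
      using additive_subgroup.a_closed[OF ideal.axioms(1)[OF ideal[of i]], of r s] s(1) z(2) rs(1) i by auto
    ultimately show ?thesis using rs(2) by blast
  qed
  then obtain y where y: "\<And>i. i < l \<Longrightarrow> y i \<in> carrier (mpoly_ring (V - C))"
      "\<And>i. i < l \<Longrightarrow> y i \<in> P (Suc i)" "\<And>i. i < l \<Longrightarrow> y i \<notin> P i"
    by (metis Diff_iff)
  obtain E c where E: "finite E" "E \<noteq> {}" "E \<subseteq> extensional {..<l}" and c: "\<And>e. e \<in> E \<Longrightarrow> c e \<noteq> 0"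
    and rel: "(\<Sum>e\<in>E. Poly_Mapping.single 0 (c e) * (\<Prod>i<l. y i ^ e i)) = 0"
    using algebraically_dependent[of "V - C" l y] V l y(1) by auto
  define mon where "mon e j = Poly_Mapping.single 0 (c e) * (\<Prod>i\<in>{j..<l}. y i ^ e i)" for e j
  have mon_closed: "mon e j \<in> carrier (mpoly_ring V)" for e j
    unfolding mon_def
    by (intro mpoly_ring_mult_closed mpoly_ring_prod_closed mpoly_ring_power_closed sub y(1)) auto
  have "\<exists>E'\<subseteq>E. E' \<noteq> {} \<and> (\<forall>e\<in>E'. \<forall>e'\<in>E'. \<forall>i<j. e i = e' i) \<and> (\<Sum>e\<in>E'. mon e j) \<in> P j"
    if "j \<le> l" for j
    using that
  proof (induction j)
    case 0
    have "(\<Sum>e\<in>E. mon e 0) \<in> P 0"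
      using rel additive_subgroup.zero_closed[OF ideal.axioms(1)[OF ideal[of 0]]]
      by (simp add: mon_def atLeast0LessThan)
    then show ?case using E(2) by blast
  next
    case (Suc j)
    then have j: "j < l" by simp
    have "\<exists>E'\<subseteq>E. E' \<noteq> {} \<and> (\<forall>e\<in>E'. \<forall>e'\<in>E'. \<forall>i<j. e i = e' i) \<and> (\<Sum>e\<in>E'. mon e j) \<in> P j"
      using j by (intro Suc.IH) simp
    then obtain E' where E': "E' \<subseteq> E" "E' \<noteq> {}" "\<And>e e' i. e \<in> E' \<Longrightarrow> e' \<in> E' \<Longrightarrow> i < j \<Longrightarrow> e i = e' i"
      and sum: "(\<Sum>e\<in>E'. mon e j) \<in> P j"
      by blast
    have fin: "finite E'" using E'(1) E(1) finite_subset by blast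
    \<comment> \<open>cancel the lowest power of \<open>y j\<close>, which lies outside \<open>P j\<close>; afterwards
      all terms outside \<open>E''\<close> are multiples of \<open>y j\<close> and so lie in \<open>P (Suc j)\<close>\<close>
    define m where "m = Min ((\<lambda>e. e j) ` E')"
    have m_le: "m \<le> e j" if "e \<in> E'" for e
      unfolding m_def using fin that by simp
    define E'' where "E'' = {e \<in> E'. e j = m}"
    have "m \<in> (\<lambda>e. e j) ` E'"
      unfolding m_def using fin E'(2) by (intro Min_in) auto
    then have E''_ne: "E'' \<noteq> {}" by (auto simp: E''_def)
    have yj: "y j \<in> carrier (mpoly_ring V)" using sub y(1) j by blast
    let ?W = "\<Sum>e\<in>E'. y j ^ (e j - m) * mon e (Suc j)"
    have "mon e j = y j ^ m * (y j ^ (e j - m) * mon e (Suc j))" if "e \<in> E'" for e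
    proof -
      have "y j ^ m * y j ^ (e j - m) = y j ^ e j"
        using m_le[OF that] by (simp flip: power_add)
      then have "y j ^ m * (y j ^ (e j - m) * mon e (Suc j)) = y j ^ e j * mon e (Suc j)"
        by (simp only: mult.assoc[symmetric])
      also have "\<dots> = mon e j"
        unfolding mon_def prod.atLeast_Suc_lessThan[OF j] by (rule mult.left_commute)
      finally show ?thesis by simp
    qed
    then have "(\<Sum>e\<in>E'. mon e j) = y j ^ m * ?W"
      by (simp add: sum_distrib_left)
    moreover have W: "?W \<in> carrier (mpoly_ring V)"
    proof -
      interpret cring "mpoly_ring V :: ('v, 'k) mpoly ring" by (rule cring_mpoly_ring)
      show ?thesis
        by (rule sum_in_mpoly_ideal[OF oneideal])
          (intro mpoly_ring_mult_closed mpoly_ring_power_closed yj mon_closed)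
    qed
    ultimately have "?W \<in> P j"
      using primeideal_power_multD[OF prime yj y(3)[OF j] W, of m] sum j by simp
    then have WSuc: "?W \<in> P (Suc j)"
      using prime_chain_mono[OF chain, of j "Suc j"] j by auto
    have split: "?W = (\<Sum>e\<in>E'-E''. y j ^ (e j - m) * mon e (Suc j)) + (\<Sum>e\<in>E''. mon e (Suc j))"
    proof -
      have "E'' \<subseteq> E'" by (auto simp: E''_def)
      then have "?W = (\<Sum>e\<in>E'-E''. y j ^ (e j - m) * mon e (Suc j))
          + (\<Sum>e\<in>E''. y j ^ (e j - m) * mon e (Suc j))"
        using fin by (rule sum.subset_diff)
      then show ?thesis by (simp add: E''_def)
    qed
    have ideal_Suc: "ideal (P (Suc j)) (mpoly_ring V)" using ideal j by simp
    have "y j ^ (e j - m) * mon e (Suc j) \<in> P (Suc j)" if "e \<in> E' - E''" for e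
    proof -
      have "m < e j" using that m_le[of e] by (auto simp: E''_def)
      then have "y j ^ (e j - m) = y j ^ (e j - m - 1) * y j"
        using power_minus_mult[of "e j - m" "y j"] by simp
      then have "y j ^ (e j - m) * mon e (Suc j) = (y j ^ (e j - m - 1) * mon e (Suc j)) * y j"
        by (simp add: mult_ac)
      also have "\<dots> \<in> P (Suc j)"
        by (intro mpoly_ideal_mult[OF ideal_Suc y(2)[OF j]] mpoly_ring_mult_closed
            mpoly_ring_power_closed yj mon_closed)
      finally show ?thesis .
    qed
    then have "(\<Sum>e\<in>E'-E''. y j ^ (e j - m) * mon e (Suc j)) \<in> P (Suc j)"
      by (rule sum_in_mpoly_ideal[OF ideal_Suc])
    from mpoly_ideal_minus[OF ideal_Suc WSuc this]
    have "(\<Sum>e\<in>E''. mon e (Suc j)) \<in> P (Suc j)"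
      unfolding split add_diff_cancel_left' .
    moreover have "e i = e' i" if "e \<in> E''" "e' \<in> E''" "i < Suc j" for e e' i
      using that E'(3) by (cases "i = j") (auto simp: E''_def)
    moreover have "E'' \<subseteq> E" using E'(1) by (auto simp: E''_def)
    ultimately show ?case
      using E''_ne by (intro exI[of _ E'']) blast
  qed
  from this[OF order_refl] obtain E' where E': "E' \<subseteq> E" "E' \<noteq> {}" "\<And>e e' i. e \<in> E' \<Longrightarrow> e' \<in> E' \<Longrightarrow> i < l \<Longrightarrow> e i = e' i"
      and sum: "(\<Sum>e\<in>E'. mon e l) \<in> P l"
    by blast
  obtain e where e: "e \<in> E'" using E'(2) by blast
  have "e' = e" if "e' \<in> E'" for e'
    using E'(1) E(3) e that by (intro extensionalityI[of _ "{..<l}"] E'(3)) auto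
  then have "E' = {e}" using e by blast
  then have "Poly_Mapping.single 0 (c e) \<in> P l"
    using sum by (simp add: mon_def)
  then have "Poly_Mapping.single 0 (inverse (c e)) * Poly_Mapping.single 0 (c e) \<in> P l"
    using mpoly_ideal_mult[OF ideal[of l], of "Poly_Mapping.single 0 (c e)" "Poly_Mapping.single 0 (inverse (c e))"]
    by simp
  moreover have "c e \<noteq> 0" using e E'(1) c by blast
  ultimately have "1 \<in> P l"
    by (simp add: mult_single)
  then show False using one_notin_primeideal[OF prime[of l]] by simp
qed


section \<open>Squarefree monomial ideals\<close>

text \<open>
  Adjoining the elements of \<open>D - C\<close> one by one.
\<close>

lemma var_ideal_chain:
  assumes V: "finite V" and "C \<subseteq> D" "D \<subseteq> V"
  obtains P where "prime_chain (mpoly_ring V :: ('v::linorder, 'k::idom) mpoly ring) (card (D - C)) P"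
    "P 0 = var_ideal V C" "P (card (D - C)) = var_ideal V D"
proof -
  have fin: "finite (D - C)" using assms finite_subset by blast
  obtain f where f: "bij_betw f {0..<card (D - C)} (D - C)"
    using ex_bij_betw_nat_finite[OF fin] by blast
  then have im: "f ` {0..<card (D - C)} = D - C" and inj: "inj_on f {0..<card (D - C)}"
    by (auto simp: bij_betw_def)
  define P :: "nat \<Rightarrow> ('v, 'k) mpoly set" where "P i = var_ideal V (C \<union> f ` {0..<i})" for i
  have "P i \<subset> P (Suc i)" if i: "i < card (D - C)" for i
    unfolding P_def
  proof (rule var_ideal_psubset)
    have "f i \<in> D - C" using im i by auto
    moreover have "f i \<notin> f ` {0..<i}"
      using inj i by (fastforce dest: inj_onD)
    ultimately show "C \<union> f ` {0..<i} \<subset> C \<union> f ` {0..<Suc i}"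
      by (auto simp: atLeast0_lessThan_Suc)
    have "f ` {0..<Suc i} \<subseteq> f ` {0..<card (D - C)}" using i by (intro image_mono) auto
    then show "C \<union> f ` {0..<Suc i} \<subseteq> V" using im assms by blast
  qed
  then have "prime_chain (mpoly_ring V) (card (D - C)) P"
    using primeideal_var_ideal by (auto simp: prime_chain_def P_def)
  moreover have "P 0 = var_ideal V C" by (simp add: P_def)
  moreover have "C \<union> (D - C) = D" using assms by blast
  then have "P (card (D - C)) = var_ideal V D" by (simp add: P_def im)
  ultimately show thesis using that by blast
qed

text \<open>
  The primes above a squarefree monomial ideal are controlled by their variables: the set of
  variables outside such a prime contains the support of no generator, and conversely the
  complement of a set \<open>F\<close> of this kind generates a prime above the ideal. The height of that
  prime is bounded above without localization: any chain below it is prolonged by \<open>card F\<close>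
  steps to the ideal of all variables, and the whole chain has at most \<open>card V\<close> steps.
\<close>

lemma squarefree_monomial_ideal_dimension:
  fixes V :: "'v::linorder set" and \<A> :: "'v set set"
  defines "R \<equiv> (mpoly_ring V :: ('v, 'k::field) mpoly ring)"
  defines "I \<equiv> Idl\<^bsub>R\<^esub> {(\<Prod>u\<in>A. mvar u) | A. A \<in> \<A>}"
  assumes V: "finite V" and \<A>: "\<And>A. A \<in> \<A> \<Longrightarrow> A \<subseteq> V"
    and F: "F \<subseteq> V" "\<And>A. A \<in> \<A> \<Longrightarrow> \<not> A \<subseteq> F"
    and max: "\<And>G. G \<subseteq> V \<Longrightarrow> (\<And>A. A \<in> \<A> \<Longrightarrow> \<not> A \<subseteq> G) \<Longrightarrow> card G \<le> card F"
  shows "krull_dim (R Quot I) = ereal (real (card F))"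
    and "ideal_height R I = ereal (real (card V - card F))"
proof -
  interpret cring R unfolding R_def by (rule cring_mpoly_ring)
  let ?S = "{(\<Prod>u\<in>A. mvar u) | A. A \<in> \<A>} :: ('v, 'k) mpoly set"
  have fin: "finite A" if "A \<subseteq> V" for A using that V finite_subset by blast
  have S: "?S \<subseteq> carrier R"
  proof
    fix p assume "p \<in> ?S"
    then obtain A where A: "p = (\<Prod>u\<in>A. mvar u)" "A \<in> \<A>" by blast
    show "p \<in> carrier R"
      unfolding A(1) R_def using \<A>[OF A(2)]
      by (intro mpoly_ring_prod_closed mvar_in_mpoly_ring) blast
  qed
  have I: "ideal I R" unfolding I_def by (rule genideal_ideal[OF S])
  have vars: "card (V - {u \<in> V. mvar u \<in> Q}) \<le> card F" if Q: "primeideal Q R" "I \<subseteq> Q" for Q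
  proof (rule max)
    fix A assume A: "A \<in> \<A>"
    then have "(\<Prod>u\<in>A. mvar u) \<in> Q"
      using genideal_self[OF S] Q(2) unfolding I_def by blast
    then have "\<exists>u\<in>A. mvar u \<in> Q"
      using \<A>[OF A]
      by (intro primeideal_prodD[OF Q(1)[unfolded R_def] fin] mvar_in_mpoly_ring) blast+
    then show "\<not> A \<subseteq> V - {u \<in> V. mvar u \<in> Q}" by blast
  qed blast
  let ?Q = "var_ideal V (V - F) :: ('v, 'k) mpoly set"
  have "?S \<subseteq> ?Q"
  proof
    fix p assume "p \<in> ?S"
    then obtain A where p: "p = (\<Prod>u\<in>A. mvar u)" and A: "A \<in> \<A>" by blast
    then obtain u where u: "u \<in> A" "u \<in> V - F" using F(2) \<A> by blast
    have "(\<Prod>w\<in>A - {u}. mvar w) * mvar u \<in> ?Q"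
    proof (rule mpoly_ideal_mult[OF var_ideal_ideal])
      show "mvar u \<in> ?Q" using u(2) by (simp add: mvar_in_var_ideal_iff)
      show "(\<Prod>w\<in>A - {u}. mvar w) \<in> carrier (mpoly_ring V)"
        using \<A>[OF A] by (intro mpoly_ring_prod_closed mvar_in_mpoly_ring) blast
    qed
    also have "(\<Prod>w\<in>A - {u}. mvar w) * mvar u = p"
      unfolding p prod.remove[OF fin[OF \<A>[OF A]] u(1)] by (rule mult.commute)
    finally show "p \<in> ?Q" .
  qed
  then have IQ: "I \<subseteq> ?Q"
    unfolding I_def by (intro genideal_minimal) (simp_all only: R_def var_ideal_ideal)
  obtain P where "prime_chain R (card (V - (V - F))) P" and P0: "P 0 = ?Q"
    unfolding R_def by (rule var_ideal_chain[OF V Diff_subset subset_refl, of F])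
  moreover have "V - (V - F) = F" using F(1) by blast
  ultimately have P: "prime_chain R (card F) P" by simp
  show "krull_dim (R Quot I) = ereal (real (card F))"
    unfolding krull_dim_quot[OF is_cring I]
  proof (rule antisym)
    show "(SUP l\<in>{l. \<exists>P. prime_chain R l P \<and> I \<subseteq> P 0}. ereal (real l)) \<le> ereal (real (card F))"
    proof (rule SUP_least)
      fix l assume "l \<in> {l. \<exists>P. prime_chain R l P \<and> I \<subseteq> P 0}"
      then obtain P where P: "prime_chain R l P" "I \<subseteq> P 0" by blast
      then have "primeideal (P 0) R" by (simp add: prime_chain_def)
      then have "card (V - {u \<in> V. mvar u \<in> P 0}) \<le> card F" using vars P(2) by blast
      moreover have "l \<le> card (V - {u \<in> V. mvar u \<in> P 0})"
        using P(1) unfolding R_def by (rule prime_chain_length_le[OF V]) simp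
      ultimately show "ereal (real l) \<le> ereal (real (card F))" by simp
    qed
    show "ereal (real (card F)) \<le> (SUP l\<in>{l. \<exists>P. prime_chain R l P \<and> I \<subseteq> P 0}. ereal (real l))"
      using P P0 IQ by (intro SUP_upper) auto
  qed
  show "ideal_height R I = ereal (real (card V - card F))"
  proof (rule antisym)
    have "prime_height R ?Q \<le> ereal (real (card V - card F))"
      unfolding prime_height_def
    proof (rule SUP_least)
      fix l assume "l \<in> {l. \<exists>P. prime_chain R l P \<and> P l = ?Q}"
      then obtain P' where P': "prime_chain R l P'" "P' l = ?Q" by blast
      have "prime_chain R (l + card F) (\<lambda>i. if i \<le> l then P' i else P (i - l))"
        unfolding prime_chain_def
      proof (intro conjI allI impI)
        fix i assume i: "i < l + card F"
        consider "i < l" | "i = l" | "l < i" by linarith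
        then show "(if i \<le> l then P' i else P (i - l)) \<subset> (if Suc i \<le> l then P' (Suc i) else P (Suc i - l))"
        proof cases
          case 1
          then show ?thesis using P'(1) by (simp add: prime_chain_def)
        next
          case 2
          then have "P 0 \<subset> P (Suc 0)" using P i unfolding prime_chain_def by simp
          then show ?thesis using 2 P0 P'(2) by simp
        next
          case 3
          then have "i - l < card F" "Suc i - l = Suc (i - l)" using i by auto
          then show ?thesis using P 3 by (simp add: prime_chain_def)
        qed
      qed (use P P' in \<open>auto simp: prime_chain_def\<close>)
      then have "l + card F \<le> card (V - {})"
        unfolding R_def by (rule prime_chain_length_le[OF V]) simp
      then show "ereal (real l) \<le> ereal (real (card V - card F))" by simp
    qed
    then show "ideal_height R I \<le> ereal (real (card V - card F))"
      unfolding ideal_height_def using IQ primeideal_var_ideal unfolding R_def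
      by (intro INF_lower2[of ?Q]) auto
    show "ereal (real (card V - card F)) \<le> ideal_height R I"
      unfolding ideal_height_def
    proof (rule INF_greatest)
      fix Q assume "Q \<in> {Q. primeideal Q R \<and> I \<subseteq> Q}"
      then have Q: "primeideal Q R" "I \<subseteq> Q" by auto
      define C where "C = {u \<in> V. mvar u \<in> Q}"
      have "card (V - C) \<le> card F" using vars[OF Q] by (simp add: C_def)
      then have cC: "card V - card F \<le> card C"
        using card_Diff_subset[of C V] fin[of C] by (simp add: C_def)
      have "C \<subseteq> V" by (auto simp: C_def)
      obtain P' where "prime_chain R (card (C - {})) P'" "P' (card (C - {})) = var_ideal V C"
        unfolding R_def by (rule var_ideal_chain[OF V empty_subsetI \<open>C \<subseteq> V\<close>])
      then have P': "prime_chain R (card C) P'" "P' (card C) = var_ideal V C" by simp_all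
      have "ideal Q R" using Q(1) by (simp add: primeideal_def)
      then have CQ: "var_ideal V C \<subseteq> Q"
        unfolding R_def by (rule var_ideal_least) (simp add: C_def)
      \<comment> \<open>\<open>Q\<close> may be larger than the ideal generated by its variables, so it takes the
        place of the last member of the chain\<close>
      have "prime_chain R (card C) (\<lambda>i. if i < card C then P' i else Q)"
        unfolding prime_chain_def
      proof (intro conjI allI impI)
        fix i assume i: "i < card C"
        then have "P' i \<subset> P' (Suc i)" using P'(1) by (simp add: prime_chain_def)
        then show "(if i < card C then P' i else Q) \<subset> (if Suc i < card C then P' (Suc i) else Q)"
          using i P'(2) CQ by (cases "Suc i = card C") auto
      qed (use P' Q in \<open>auto simp: prime_chain_def\<close>)
      then have "ereal (real (card C)) \<le> prime_height R Q"
        unfolding prime_height_def by (intro SUP_upper) auto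
      then show "ereal (real (card V - card F)) \<le> prime_height R Q"
        using cC by (meson ereal_less_eq(3) of_nat_mono order_trans)
    qed
  qed
qed


section \<open>Matchings in wheels\<close>

text \<open>
  Each of the \<open>k\<close> pairs meets \<open>F\<close> in at most one element unless it is contained in
  \<open>F\<close>.
\<close>

lemma pigeonhole_full_pairs:
  fixes F :: "'a set"
  assumes pairs: "\<And>j. j < k \<Longrightarrow> card (B j) = 2" and F: "finite F" "F \<subseteq> (\<Union>j<k. B j)"
    and size: "k + p \<le> card F"
  obtains J where "J \<subseteq> {..<k}" "card J = p" "\<And>j. j \<in> J \<Longrightarrow> B j \<subseteq> F"
proof -
  let ?J = "{..<k} \<inter> {j. B j \<subseteq> F}"
  have "card F = card (\<Union>j<k. F \<inter> B j)"
    using F(2) by (intro arg_cong[where f = card]) blast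
  also have "\<dots> \<le> (\<Sum>j<k. card (F \<inter> B j))"
    by (rule card_UN_le) simp
  also have "\<dots> \<le> (\<Sum>j<k. 1 + of_bool (B j \<subseteq> F))"
  proof (rule sum_mono)
    fix j assume "j \<in> {..<k}"
    then have c: "card (B j) = 2" using pairs by simp
    then have fin: "finite (B j)" by (simp add: card_ge_0_finite)
    show "card (F \<inter> B j) \<le> 1 + of_bool (B j \<subseteq> F)"
    proof (cases "B j \<subseteq> F")
      case True
      then show ?thesis using c card_mono[OF fin, of "F \<inter> B j"] by simp
    next
      case False
      then have "F \<inter> B j \<subset> B j" by blast
      then have "card (F \<inter> B j) < card (B j)" by (rule psubset_card_mono[OF fin])
      then show ?thesis using c False by simp
    qed
  qed
  also have "\<dots> = k + card ?J"
    by (subst sum.distrib) simp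
  finally have "p \<le> card ?J" using size by simp
  then obtain J where "J \<subseteq> ?J" "card J = p"
    using obtain_subset_with_card_n by blast
  show thesis
  proof (rule that)
    show "J \<subseteq> {..<k}" "card J = p" using \<open>J \<subseteq> ?J\<close> \<open>card J = p\<close> by simp_all
    show "B j \<subseteq> F" if "j \<in> J" for j using that \<open>J \<subseteq> ?J\<close> by blast
  qed
qed

text \<open>
  Indexing the rim periodically from an arbitrary starting point turns a rotation of the wheel into
  a shift of the index.
\<close>

definition rim :: "nat \<Rightarrow> nat \<Rightarrow> wheel_vertex" where
  "rim n i = Rim (Suc (i mod n))"

lemma rim_eq_iff:
  assumes "i \<in> {s..<s + n}" "j \<in> {s..<s + n}"
  shows "rim n i = rim n j \<longleftrightarrow> i = j"
proof -
  have *: "i = j" if "i \<in> {s..<s + n}" "j \<in> {s..<s + n}" "i mod n = j mod n" "i \<le> j" for i j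
  proof -
    have "n dvd j - i" using that mod_eq_dvd_iff_nat[of i j n] by simp
    moreover have "j - i < n" using that by auto
    ultimately show ?thesis using that by (auto dest: dvd_imp_le)
  qed
  show ?thesis
    using *[of i j] *[of j i] assms by (metis nat.inject nle_le rim_def wheel_vertex.inject)
qed

lemma rim_image:
  assumes "n > 0"
  shows "rim n ` {s..<s + n} = Rim ` {1..n}"
proof (rule card_subset_eq)
  show "rim n ` {s..<s + n} \<subseteq> Rim ` {1..n}"
    using assms by (auto simp: rim_def Suc_le_eq)
  have "inj_on (rim n) {s..<s + n}" using rim_eq_iff by (auto simp: inj_on_def)
  then show "card (rim n ` {s..<s + n}) = card (Rim ` {1..n})"
    by (simp add: card_image inj_on_def)
qed simp

lemma rim_edge:
  assumes "n > 0"
  shows "{rim n i, rim n (Suc i)} \<in> edges (wheel n)"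
proof (cases "Suc (i mod n) = n")
  case True
  then have "Suc i mod n = 0" by (simp add: mod_Suc)
  then show ?thesis using True by (simp add: wheel_def rim_def)
next
  case False
  then have "Suc i mod n = Suc (i mod n)" by (simp add: mod_Suc)
  moreover have "Suc (i mod n) < n"
    using False assms by (metis Suc_lessI mod_less_divisor)
  ultimately show ?thesis by (auto simp: wheel_def rim_def)
qed

text \<open>
  For even \<open>n\<close> the rim is partitioned into \<open>n div 2\<close> edges, and the pigeonhole
  principle applies. For odd \<open>n\<close> such a family of edges misses one vertex; if \<open>F\<close> is not
  the whole rim, the family is rotated so that the missed vertex lies outside \<open>F\<close>.
\<close>

lemma rim_matching:
  assumes n: "n \<ge> 2" and F: "F \<subseteq> Rim ` {1..n}" and p: "p \<le> n div 2" and size: "n div 2 + p \<le> card F"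
  shows "\<exists>M. q_matching (wheel n) p M \<and> \<Union>M \<subseteq> F"
proof -
  define k where "k = n div 2"
  obtain s where s: "odd n \<Longrightarrow> rim n s \<notin> F \<or> F = Rim ` {1..n}"
  proof (cases "F = Rim ` {1..n}")
    case False
    then obtain x where "x \<in> Rim ` {1..n}" "x \<notin> F" using F by blast
    then obtain s where "rim n s \<notin> F"
    proof -
      have "x \<in> rim n ` {0..<0 + n}"
        using \<open>x \<in> Rim ` {1..n}\<close> rim_image[of n 0] n by simp
      then show thesis using \<open>x \<notin> F\<close> that by blast
    qed
    then show thesis using that by blast
  qed (use that in blast)
  define B where "B j = {rim n (s + 2 * j + 1), rim n (s + 2 * j + 2)}" for j
  have inj: "rim n (s + i) = rim n (s + j) \<longleftrightarrow> i = j" if "1 \<le> i" "i \<le> 2 * k" "1 \<le> j" "j \<le> 2 * k" for i j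
    using rim_eq_iff[of "s + i" "s + 1" n "s + j"] that by (auto simp: k_def)
  have cardB: "card (B j) = 2" if "j < k" for j
    using inj[of "2 * j + 1" "2 * j + 2"] that by (auto simp: B_def card_2_iff)
  have disj: "disjnt (B i) (B j)" if ij: "i < k" "j < k" "i \<noteq> j" for i j
  proof -
    \<comment> \<open>halving the index recovers the number of the edge\<close>
    have "rim n (s + (2 * i + a)) \<noteq> rim n (s + (2 * j + b))" if "a \<in> {1, 2}" "b \<in> {1, 2}" for a b
    proof -
      have "(2 * i + a - 1) div 2 = i" "(2 * j + b - 1) div 2 = j" using that by auto
      then have "2 * i + a \<noteq> 2 * j + b" using ij(3) by metis
      moreover have "1 \<le> 2 * i + a" "2 * i + a \<le> 2 * k" "1 \<le> 2 * j + b" "2 * j + b \<le> 2 * k"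
        using that ij by auto
      ultimately show ?thesis using inj by blast
    qed
    from this[of 1 1] this[of 1 2] this[of 2 1] this[of 2 2] show ?thesis
      by (simp add: B_def disjnt_def)
  qed
  have UnB: "(\<Union>j<k. B j) = (\<lambda>i. rim n (s + i)) ` {1..2 * k}"
  proof
    show "(\<Union>j<k. B j) \<subseteq> (\<lambda>i. rim n (s + i)) ` {1..2 * k}"
    proof
      fix x assume "x \<in> (\<Union>j<k. B j)"
      then obtain j where "j \<in> {..<k}" "x \<in> B j" by blast
      then have "x = rim n (s + (2 * j + 1)) \<or> x = rim n (s + (2 * j + 2))"
        by (simp add: B_def)
      moreover have "2 * j + 1 \<in> {1..2 * k}" "2 * j + 2 \<in> {1..2 * k}"
        using \<open>j \<in> {..<k}\<close> by auto
      ultimately show "x \<in> (\<lambda>i. rim n (s + i)) ` {1..2 * k}" by blast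
    qed
    show "(\<lambda>i. rim n (s + i)) ` {1..2 * k} \<subseteq> (\<Union>j<k. B j)"
    proof
      fix x assume "x \<in> (\<lambda>i. rim n (s + i)) ` {1..2 * k}"
      then obtain i where x: "x = rim n (s + i)" and i: "i \<in> {1..2 * k}" by blast
      define j where "j = (i - 1) div 2"
      have "j < k" "i = 2 * j + 1 \<or> i = 2 * j + 2" using i by (auto simp: j_def)
      then show "x \<in> (\<Union>j<k. B j)" by (auto simp: B_def x)
    qed
  qed
  obtain J where J: "J \<subseteq> {..<k}" "card J = p" "\<And>j. j \<in> J \<Longrightarrow> B j \<subseteq> F"
  proof (cases "F = Rim ` {1..n}")
    case True
    have "B j \<subseteq> F" for j
      using n by (auto simp: True B_def rim_def Suc_le_eq)
    moreover have "card {..<p} = p" "{..<p} \<subseteq> {..<k}" using p by (auto simp: k_def)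
    ultimately show thesis using that by blast
  next
    case False
    have "F \<subseteq> (\<Union>j<k. B j)"
    proof
      fix x assume x: "x \<in> F"
      then have "x \<in> rim n ` {s + 1..<s + 1 + n}"
        using F rim_image[of n "s + 1"] n by auto
      then obtain i where i: "i \<in> {s + 1..<s + 1 + n}" "x = rim n i" by blast
      define i' where "i' = i - s"
      have i': "1 \<le> i'" "i' \<le> n" "x = rim n (s + i')" using i by (auto simp: i'_def)
      have "i' \<noteq> n" if "odd n"
      proof
        assume "i' = n"
        then have "x = rim n s" using i' by (simp add: rim_def)
        then show False using s[OF that] False x by simp
      qed
      then have "i' \<le> 2 * k"
        using i' by (cases "even n") (auto simp: k_def)
      then show "x \<in> (\<Union>j<k. B j)" unfolding UnB using i' by auto
    qed
    then show thesis
      using pigeonhole_full_pairs[of k B F p] cardB F size finite_subset[OF F] that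
      by (auto simp: k_def)
  qed
  have "inj_on B J"
  proof (rule inj_onI)
    fix i j assume ij: "i \<in> J" "j \<in> J" "B i = B j"
    show "i = j"
    proof (rule ccontr)
      assume "i \<noteq> j"
      then have "disjnt (B i) (B j)" using disj ij J by blast
      then show False using ij by (auto simp: B_def disjnt_def)
    qed
  qed
  then have "card (B ` J) = p" using J by (simp add: card_image)
  moreover have "finite (B ` J)" using J finite_subset by blast
  moreover have "B ` J \<subseteq> edges (wheel n)"
    using rim_edge[of n] n by (auto simp: B_def)
  moreover have "pairwise disjnt (B ` J)"
    using disj J unfolding pairwise_def by blast
  ultimately have "q_matching (wheel n) p (B ` J)" by (simp add: q_matching_def)
  then show ?thesis using J by blast
qed

lemma matching_card_verts:
  assumes "q_matching (wheel n) p M" "n \<ge> 3"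
  shows "card (\<Union>M) = 2 * p"
proof -
  have M: "finite M" "card M = p" "pairwise disjnt M" "\<And>e. e \<in> M \<Longrightarrow> card e = 2"
    using assms simple_graph_wheel[of n] by (auto simp: q_matching_def simple_graph_def)
  then have "\<And>e. e \<in> M \<Longrightarrow> finite e" by (simp add: card_ge_0_finite)
  then show ?thesis
    using M card_Union_disjoint[of M] by simp
qed

text \<open>
  If the hub belongs to \<open>F\<close>, then the rim vertices in \<open>F\<close> contain a
  \<open>(q - 1)\<close>-matching, which covers \<open>2 * (q - 1) < n div 2 + (q - 1)\<close> of them, and the hub is
  matched with a vertex left over.
\<close>

lemma wheel_matching_in_large_set:
  assumes n: "n \<ge> 3" and q: "1 \<le> q" "q \<le> n div 2" and F: "F \<subseteq> verts (wheel n)"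
    and size: "n div 2 + q \<le> card F"
  shows "\<exists>M. q_matching (wheel n) q M \<and> \<Union>M \<subseteq> F"
proof (cases "Hub \<in> F")
  case False
  then have "F \<subseteq> Rim ` {1..n}" using F by (auto simp: wheel_def)
  then show ?thesis using rim_matching[of n F q] n q size by simp
next
  case True
  define G where "G = F - {Hub}"
  have G: "G \<subseteq> Rim ` {1..n}" using F by (auto simp: wheel_def G_def)
  then have finG: "finite G" using finite_subset by blast
  have cG: "n div 2 + (q - 1) \<le> card G"
    using size True q finG by (simp add: G_def card_Diff_singleton)
  have "2 \<le> n" "q - 1 \<le> n div 2" using n q by simp_all
  obtain M where M: "q_matching (wheel n) (q - 1) M" "\<Union>M \<subseteq> G"
    using rim_matching[OF \<open>2 \<le> n\<close> G \<open>q - 1 \<le> n div 2\<close> cG] by blast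
  have "card (\<Union>M) < card G"
    using matching_card_verts[OF M(1) n] cG q by linarith
  then obtain x where x: "x \<in> G" "x \<notin> \<Union>M"
    using M(2) by (metis less_irrefl subsetI subset_antisym)
  obtain i where "x = Rim i" "1 \<le> i" "i \<le> n" using x(1) G by auto
  then have "{Hub, x} \<in> edges (wheel n)" by (auto simp: wheel_def)
  moreover have disj: "disjnt {Hub, x} e" if "e \<in> M" for e
    using that x M(2) by (auto simp: disjnt_def G_def)
  moreover have "{Hub, x} \<notin> M" using x by blast
  ultimately have "q_matching (wheel n) q (insert {Hub, x} M)"
    using M(1) q by (auto simp: q_matching_def pairwise_insert disjnt_sym)
  moreover have "\<Union>(insert {Hub, x} M) \<subseteq> F" using M(2) x True by (auto simp: G_def)
  ultimately show ?thesis by blast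
qed

text \<open>
  Take the odd rim vertices below \<open>n\<close> and the first \<open>q - 1\<close> even ones. As
  \<open>n\<close> itself is left out even if it is odd, no two of the odd vertices are adjacent. Hence the
  even ones meet every edge within the set, and disjoint edges need distinct ones.
\<close>

lemma wheel_large_set_without_matching:
  assumes n: "n \<ge> 3" and q: "1 \<le> q" "q \<le> n div 2"
  obtains F where "F \<subseteq> verts (wheel n)" "card F = n div 2 + q - 1"
    "\<And>M. q_matching (wheel n) q M \<Longrightarrow> \<not> \<Union>M \<subseteq> F"
proof
  let ?O = "(\<lambda>j. Rim (2 * j + 1)) ` {..<n div 2}"
  let ?E = "(\<lambda>j. Rim (2 * j + 2)) ` {..<q - 1}"
  show "?O \<union> ?E \<subseteq> verts (wheel n)" using q by (auto simp: wheel_def)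
  have "Rim (2 * i + 1) \<noteq> Rim (2 * j + 2)" for i j
    by simp presburger
  then have "?O \<inter> ?E = {}" by blast
  moreover have "card ?O = n div 2" "card ?E = q - 1"
    by (simp_all add: card_image inj_on_def)
  ultimately show "card (?O \<union> ?E) = n div 2 + q - 1"
    using q by (simp add: card_Un_disjoint)
  fix M assume M: "q_matching (wheel n) q M"
  show "\<not> \<Union>M \<subseteq> ?O \<union> ?E"
  proof
    assume sub: "\<Union>M \<subseteq> ?O \<union> ?E"
    have "e \<inter> ?E \<noteq> {}" if e: "e \<in> M" for e
    proof
      assume "e \<inter> ?E = {}"
      then have eO: "e \<subseteq> ?O" using sub e by blast
      have "e \<in> edges (wheel n)" using M e by (auto simp: q_matching_def)
      then consider i where "e = {Rim i, Rim (Suc i)}" | "e = {Rim n, Rim 1}" | i where "e = {Hub, Rim i}"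
        by (auto simp: wheel_def)
      then show False
      proof cases
        case 1
        then obtain a b where "i = 2 * a + 1" "Suc i = 2 * b + 1" using eO by auto
        then show False by presburger
      next
        case 2
        then show False using eO by auto
      next
        case 3
        then show False using eO by auto
      qed
    qed
    then have "\<exists>f. \<forall>e\<in>M. f e \<in> e \<inter> ?E" by (intro bchoice) blast
    then obtain f where f: "\<And>e. e \<in> M \<Longrightarrow> f e \<in> e \<inter> ?E" by blast
    have "inj_on f M"
    proof (rule inj_onI)
      fix d e assume de: "d \<in> M" "e \<in> M" "f d = f e"
      then have "\<not> disjnt d e" using f unfolding disjnt_def by (metis Int_iff empty_iff)
      then show "d = e" using M de by (auto simp: q_matching_def pairwise_def)
    qed
    then have "card M \<le> card ?E" using f by (intro card_inj_on_le[of f]) auto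
    then show False using M q \<open>card ?E = q - 1\<close> by (simp add: q_matching_def)
  qed
qed


text \<open>
  Any linear order on the vertices serves to order the monomials; here the hub comes first.
\<close>

instantiation wheel_vertex :: linorder
begin

definition wheel_vertex_index :: "wheel_vertex \<Rightarrow> nat" where
  "wheel_vertex_index u = (case u of Hub \<Rightarrow> 0 | Rim i \<Rightarrow> Suc i)"

definition less_eq_wheel_vertex :: "wheel_vertex \<Rightarrow> wheel_vertex \<Rightarrow> bool" where
  "u \<le> w \<longleftrightarrow> wheel_vertex_index u \<le> wheel_vertex_index w"

definition less_wheel_vertex :: "wheel_vertex \<Rightarrow> wheel_vertex \<Rightarrow> bool" where
  "u < w \<longleftrightarrow> wheel_vertex_index u < wheel_vertex_index w"

instance
  by standard
    (auto simp: less_eq_wheel_vertex_def less_wheel_vertex_def wheel_vertex_index_def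
      split: wheel_vertex.splits)

end


section \<open>Dimension and height\<close>

theorem theorem5p3:
  fixes R :: "(wheel_vertex, 'k::field) mpoly ring" and n q :: nat
  assumes "n \<ge> 3" and "1 \<le> q" and "q \<le> n div 2"
    and "R = mpoly_ring (verts (wheel n))"
  shows "krull_dim (R Quot squarefree_power (wheel n) q)
           = ereal (real (n div 2) + real q - 1)
       \<and> ideal_height R (squarefree_power (wheel n) q)
           = ereal ((real n + 1) - real (n div 2) - real q + 1)"
proof -
  let ?V = "verts (wheel n)"
  let ?\<A> = "{\<Union>M | M. q_matching (wheel n) q M}"
  obtain F where F: "F \<subseteq> ?V" "card F = n div 2 + q - 1"
      "\<And>M. q_matching (wheel n) q M \<Longrightarrow> \<not> \<Union>M \<subseteq> F"
    using wheel_large_set_without_matching assms(1-3) by blast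
  have max: "card G \<le> card F" if "G \<subseteq> ?V" "\<And>A. A \<in> ?\<A> \<Longrightarrow> \<not> A \<subseteq> G" for G
  proof (rule ccontr)
    assume "\<not> card G \<le> card F"
    then have "n div 2 + q \<le> card G" using F(2) assms(2) by simp
    then show False
      using wheel_matching_in_large_set[OF assms(1-3) that(1)] that(2) by blast
  qed
  have V: "finite ?V" by (simp add: wheel_def)
  have sub: "A \<subseteq> ?V" if "A \<in> ?\<A>" for A
    using that simple_graph_wheel[OF assms(1)] by (fastforce simp: q_matching_def simple_graph_def)
  have I: "(squarefree_power (wheel n) q :: (wheel_vertex, 'k) mpoly set) = Idl\<^bsub>mpoly_ring ?V\<^esub> {(\<Prod>u\<in>A. mvar u) | A. A \<in> ?\<A>}"
    unfolding squarefree_power_def by (rule arg_cong[where f = "genideal (mpoly_ring ?V)"]) auto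
  have avoid: "\<not> A \<subseteq> F" if "A \<in> ?\<A>" for A using that F(3) by blast
  have "krull_dim (R Quot squarefree_power (wheel n) q) = ereal (real (card F))"
    unfolding assms(4) I
    by (rule squarefree_monomial_ideal_dimension(1)[OF V sub F(1) avoid max])
  moreover have "ideal_height R (squarefree_power (wheel n) q) = ereal (real (card ?V - card F))"
    unfolding assms(4) I
    by (rule squarefree_monomial_ideal_dimension(2)[OF V sub F(1) avoid max])
  moreover have "card F \<le> card ?V" using V F(1) by (rule card_mono)
  ultimately show ?thesis
    using F(2) assms(2) by (simp add: card_verts_wheel of_nat_diff)
qed

end
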